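(* Let $S\subseteq\mathbb{Z}$ be an arbitrary subset, let $f=\frac{g}{d}\in\mathrm{Int}(S,\mathbb{Z})$ be an image primitive polynomial of degree $k$, and let $a_0,a_1,\ldots,a_k$ be a $d_k$-ordering of $S$. Then $f$ is irreducible in $\mathrm{Int}(S,\mathbb{Z})$ if and only if for any factorization $$g=\Big(\sum_{i=0}^{k_1} b_iF_i(x)\Big)\Big(\sum_{j=0}^{k_2} c_jF_j(x)\Big)$$ there exist a prime $p\mid d$ and non-zero positive integers $r\le k_1$ and $s\le k_2$ such that $$\frac{\mu_r(d,p)\,\mu_s(d,p)}{w_p(d)}\nmid w_p(b_rc_s).$$
   Context: $\mathrm{Int}(S,\mathbb{Z})=\{f\in\mathbb{Q}[x]: f(S)\subseteq\mathbb{Z}\}$. A polynomial $f\in\mathrm{Int}(S,\mathbb{Z})$ is image primitive if no prime $p$ divides $f(a)$ for all $a\in S$. In writing $f=\frac{g}{d}$, the polynomial $g\in\mathbb{Z}[x]$ and the integer $d\in\mathbb{Z}$ are assumed to be unique. Here $F_i(x)=(x-a_0)(x-a_1)\cdots(x-a_{i-1})$, with $F_0=1$ (empty product), and $b_i,c_j$ are the integer coefficients of the two factors of $g$ expanded in the $F_i$. For a prime $p$ and an integer $n$, $w_p(n)$ denotes the highest power of $p$ dividing $n$ (e.g. $w_2(12)=2^2$). A $p$-ordering of $S$ is a sequence $u_0,u_1,u_2,\ldots$ of elements of $S$ in which $u_0\in S$ is arbitrary and, for each $n\ge1$, $u_n\in S$ is chosen to minimize the highest power of $p$ dividing $\prod_{i=0}^{n-1}(u_n-u_i)$.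 The minimized powers do not depend on the choice of $p$-ordering. The generalized (Bhargava) factorial is $n!_S=\prod_p w_p\big((u_n-u_0)(u_n-u_1)\cdots(u_n-u_{n-1})\big)$, the product being over all primes $p$, where for each $p$ the sequence $(u_i)$ is a $p$-ordering of $S$; $0!_S=1$. $d_k$-ordering: for given integers $d$ and $k$, let $p_1,\ldots,p_t$ be all the prime divisors of $d$, and for $1\le j\le t$ let $(u_{ij})_{i\ge0}$ be a $p_j$-ordering of $S$. A $d_k$-ordering $x_0,\ldots,x_k$ of $S$ is a solution in integers (not necessarily in $S$) of the congruences $x_i\equiv u_{ij}\pmod{p_j^{e_{kj}+1}}$ for all $1\le j\le t$ (for each $0\le i\le k$), where $p_j^{e_{kj}}=w_{p_j}(k!_S)$. For $d$, a prime $p$ and $i\ge0$ with $w_p(i!_S)\le w_p(d)$, $\mu_i(d,p)$ denotes the power of $p$ such that $\mu_i(d,p)\,w_p(i!_S)=w_p(d)$. *)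

theory Defs
  imports
    "HOL-Algebra.Ring_Divisibility"
    "HOL-Computational_Algebra.Computational_Algebra"
    "HOL-Number_Theory.Cong"
begin

hide_const (open) Divisibility.prime UnivPoly.monom UnivPoly.coeff

definition Int_poly :: "int set \<Rightarrow> rat poly set" where
  "Int_poly S = {f. \<forall>a\<in>S. poly f (of_int a) \<in> \<int>}"

definition Int_ring :: "int set \<Rightarrow> rat poly ring" where
  "Int_ring S = \<lparr>carrier = Int_poly S, mult = (*), one = 1, zero = 0, add = (+)\<rparr>"

definition image_primitive :: "int set \<Rightarrow> rat poly \<Rightarrow> bool" where
  "image_primitive S f \<longleftrightarrow> f \<in> Int_poly S \<and>
     \<not> (\<exists>p::int. prime p \<and> (\<forall>a\<in>S. \<exists>m::int. poly f (of_int a) = of_int (p * m)))"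

text \<open>The unique expression \<open>f = g/d\<close>: lowest terms, with positive denominator.\<close>

definition reduced_fraction :: "rat poly \<Rightarrow> int poly \<Rightarrow> int \<Rightarrow> bool" where
  "reduced_fraction f g d \<longleftrightarrow>
     f = smult (1 / of_int d) (map_poly of_int g) \<and> d > 0 \<and> coprime (content g) d"

text \<open>
  The highest power of \<open>p\<close> dividing \<open>n\<close>. Every power of \<open>p\<close> divides \<open>0\<close>; the
  convention \<open>w p 0 = 0\<close> puts this value above all powers of \<open>p\<close> with respect to
  divisibility (whereas \<open>multiplicity p 0 = 0\<close> would make it \<open>1\<close>).
\<close>

definition w :: "int \<Rightarrow> int \<Rightarrow> int" where
  "w p n = (if n = 0 then 0 else p ^ multiplicity p n)"

text \<open>
  The values of \<open>w p\<close> are compared by divisibility, which is the usual order on powers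
  of \<open>p\<close> and has \<open>0\<close> as its greatest element. A \<open>u n\<close> at which the product vanishes is
  therefore chosen only when \<open>S\<close> is finite and exhausted.
\<close>

definition p_ordering :: "int set \<Rightarrow> int \<Rightarrow> (nat \<Rightarrow> int) \<Rightarrow> bool" where
  "p_ordering S p u \<longleftrightarrow> (\<forall>n. u n \<in> S) \<and>
     (\<forall>n\<ge>1. \<forall>s\<in>S. w p (\<Prod>i<n. u n - u i) dvd w p (\<Prod>i<n. s - u i))"

definition local_fact :: "int set \<Rightarrow> int \<Rightarrow> nat \<Rightarrow> int" where
  "local_fact S p n = (let u = (SOME u. p_ordering S p u) in w p (\<Prod>i<n. u n - u i))"

text \<open>
  Bhargava's factorial. If \<open>n < |S|\<close> then all but finitely many factors are \<open>1\<close>, so the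
  product over all primes is the finite product of the remaining ones. If \<open>S\<close> is finite
  and \<open>|S| \<le> n\<close>, every factor and hence the product is \<open>0\<close>.
\<close>

definition gen_fact :: "int set \<Rightarrow> nat \<Rightarrow> int" where
  "gen_fact S n =
     (if \<exists>p. prime p \<and> local_fact S p n = 0 then 0
      else \<Prod>p | prime p \<and> local_fact S p n \<noteq> 1. local_fact S p n)"

definition dk_ordering :: "int set \<Rightarrow> int \<Rightarrow> nat \<Rightarrow> (nat \<Rightarrow> int) \<Rightarrow> bool" where
  "dk_ordering S d k x \<longleftrightarrow>
     (\<forall>p. prime p \<and> p dvd d \<longrightarrow>
        (\<exists>u e. p_ordering S p u \<and> p ^ e = w p (gen_fact S k) \<and>
               (\<forall>i\<le>k. [x i = u i] (mod p ^ (e + 1)))))"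

definition F :: "(nat \<Rightarrow> int) \<Rightarrow> nat \<Rightarrow> int poly" where
  "F a i = (\<Prod>j<i. [:- a j, 1:])"

text \<open>Meaningful only if \<open>w p (gen_fact S i) \<le> w p d\<close>.\<close>

definition mu :: "int set \<Rightarrow> nat \<Rightarrow> int \<Rightarrow> int \<Rightarrow> int" where
  "mu S i d p = (THE m. (\<exists>e. m = p ^ e) \<and> m * w p (gen_fact S i) = w p d)"

text \<open>
  Divisibility with an integral cofactor for rational numbers (\<open>dvd\<close> on the field
  \<open>rat\<close> is trivial): a quotient of powers of \<open>p\<close> may be a proper fraction.
\<close>

definition rat_divides :: "rat \<Rightarrow> rat \<Rightarrow> bool" where
  "rat_divides x y \<longleftrightarrow> (\<exists>m::int. y = x * of_int m)"

end

theory Submission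
  imports Defs
begin

text \<open>
  Image primitivity and Gauss' lemma turn a factorization of \<open>f = g/d\<close> in \<open>Int(S,\<int>)\<close> into
  factorizations \<open>g = g\<^sub>1 g\<^sub>2\<close> and \<open>d = d\<^sub>1 d\<^sub>2\<close> with \<open>d\<^sub>i\<close> dividing \<open>g\<^sub>i\<close> on \<open>S\<close>, so \<open>f\<close> is reducible
  iff for some \<open>g = g\<^sub>1 g\<^sub>2\<close> the number \<open>d\<close> divides the product of the fixed divisors of \<open>g\<^sub>1\<close> and
  \<open>g\<^sub>2\<close>. This can be checked one prime \<open>p\<close> at a time. Along a \<open>p\<close>-ordering the values at
  \<open>u\<^sub>0, u\<^sub>1, \<dots>\<close> form a triangular system, whence \<open>p\<^sup>m\<close> divides \<open>\<Sum> b\<^sub>i F\<^sub>i\<close> on \<open>S\<close> iff it divides every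
  \<open>b\<^sub>i w\<^sub>p(i!\<^sub>S)\<close>. The condition of the theorem only concerns \<open>r, s \<ge> 1\<close>. The constant terms take
  care of themselves: if \<open>b\<^sub>0\<close> has smaller valuation than all \<open>b\<^sub>r w\<^sub>p(r!\<^sub>S)\<close>, then \<open>g\<^sub>1\<close> has constant
  valuation on \<open>S\<close> and \<open>g\<^sub>2\<close> absorbs the remaining power of \<open>p\<close>.
\<close>

subsection \<open>Highest prime powers\<close>

text \<open>For prime p, these are moduli that see only the p-part of a number. The value 0 is
  included since \<open>w p 0 = 0\<close>, so that every value of \<open>w p\<close> is itself such
  a modulus.\<close>

definition prime_power_or_0 :: "int \<Rightarrow> int \<Rightarrow> bool" where
  "prime_power_or_0 p M \<longleftrightarrow> M = 0 \<or> (\<exists>m. M = p ^ m)"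

lemma prime_power_or_0_power: "prime_power_or_0 p (p ^ m)"
  by (auto simp: prime_power_or_0_def)

lemma prime_power_or_0_w: "prime_power_or_0 p (w p x)"
  by (auto simp: prime_power_or_0_def w_def)

lemma w_eq_0_iff: "prime p \<Longrightarrow> w p x = 0 \<longleftrightarrow> x = 0"
  by (auto simp: w_def)

lemma w_nonneg: "prime p \<Longrightarrow> 0 \<le> w p x"
  by (auto simp: w_def prime_ge_0_int)

lemma w_1 [simp]: "w p 1 = 1"
  by (simp add: w_def)

lemma w_dvd: "w p x dvd x"
  by (auto simp: w_def multiplicity_dvd)

lemma w_dvd_w:
  assumes "prime p" "x dvd y"
  shows "w p x dvd w p y"
proof (cases "y = 0")
  case False
  with assms have "x \<noteq> 0" by auto
  with False assms show ?thesis
    by (auto simp: w_def intro!: le_imp_power_dvd dvd_imp_multiplicity_le)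
qed (simp add: w_def)

lemma coprime_prime_power:
  fixes p :: int
  assumes "prime p" "\<not> p dvd y"
  shows "coprime (p ^ m) y"
  using assms by (simp add: coprime_power_left_iff prime_imp_coprime)

text \<open>For nonzero \<open>x\<close> the cofactor of \<open>w p x\<close> in \<open>x\<close> is
  prime to p, hence invisible to a modulus p^m. Modulo 0 both sides say that the product
  vanishes.\<close>

lemma dvd_mult_w_iff:
  assumes "prime p" "prime_power_or_0 p M"
  shows "M dvd b * w p x \<longleftrightarrow> M dvd b * x"
proof (cases "M = 0 \<or> x = 0")
  case True
  then show ?thesis using w_eq_0_iff[OF assms(1), of x] by auto
next
  case False
  then obtain m where M: "M = p ^ m"
    using assms(2) by (auto simp: prime_power_or_0_def)
  obtain y where y: "x = w p x * y" "\<not> p dvd y"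
    using False assms(1) multiplicity_decompose'[of x p thesis]
    by (auto simp: w_def not_prime_unit)
  have "M dvd b * x \<longleftrightarrow> M dvd (b * w p x) * y"
    by (subst y(1)) (simp add: mult.assoc)
  also have "\<dots> \<longleftrightarrow> M dvd b * w p x"
    unfolding M by (rule coprime_dvd_mult_left_iff[OF coprime_prime_power[OF assms(1) y(2)]])
  finally show ?thesis by simp
qed

subsection \<open>Newton expansions\<close>

lemma poly_F: "poly (F a n) x = (\<Prod>i<n. x - a i)"
  by (simp add: F_def poly_prod)

lemma F_Suc: "F a (Suc n) = F a n * [:- a n, 1:]"
  by (simp add: F_def)

lemma lead_coeff_F: "lead_coeff (F a n) = 1"
  by (induction n) (simp_all only: F_Suc lead_coeff_mult, simp_all add: F_def)

lemma degree_F: "degree (F a n) = n"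
proof (induction n)
  case (Suc n)
  have "F a n \<noteq> 0" using lead_coeff_F[of a n] by auto
  with Suc show ?case unfolding F_Suc by (subst degree_mult_eq) auto
qed (simp add: F_def)

lemma poly_F_cong:
  assumes "\<And>i. i < n \<Longrightarrow> [a i = b i] (mod m)"
  shows "[poly (F a n) x = poly (F b n) x] (mod m)"
  unfolding poly_F by (intro cong_prod cong_diff cong_refl assms) auto

lemma poly_sum_F: "poly (\<Sum>i\<le>n. smult (b i) (F a i)) x = (\<Sum>i\<le>n. b i * poly (F a i) x)"
  by (simp add: poly_sum)

lemma coeff_sum_F: "coeff (\<Sum>i\<le>n. smult (b i) (F a i)) n = b n"
proof -
  have "coeff (\<Sum>i\<le>n. smult (b i) (F a i)) n = (\<Sum>i\<le>n. b i * coeff (F a i) n)"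
    by (simp add: coeff_sum)
  also have "\<dots> = (\<Sum>i\<le>n. if i = n then b n else 0)"
  proof (intro sum.cong refl)
    fix i assume "i \<in> {..n}"
    then show "b i * coeff (F a i) n = (if i = n then b n else 0)"
      using lead_coeff_F[of a i] by (auto simp: degree_F coeff_eq_0)
  qed
  finally show ?thesis by simp
qed

lemma degree_sum_F:
  assumes "b n \<noteq> 0"
  shows "degree (\<Sum>i\<le>n. smult (b i) (F a i)) = n"
proof (rule antisym)
  show "degree (\<Sum>i\<le>n. smult (b i) (F a i)) \<le> n"
    by (intro degree_sum_le) (auto intro: order.trans[OF degree_smult_le] simp: degree_F)
  show "n \<le> degree (\<Sum>i\<le>n. smult (b i) (F a i))"
    using assms by (intro le_degree) (simp add: coeff_sum_F)
qed

text \<open>F_(n+1) is monic, so a multiple of it cancels the top coefficient without leaving the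
  integers.\<close>

lemma F_expansion:
  assumes "degree h \<le> n"
  shows "\<exists>b. h = (\<Sum>i\<le>n. smult (b i) (F a i))"
  using assms
proof (induction n arbitrary: h)
  case 0
  then obtain c where "h = [:c:]" by (metis degree_eq_zeroE le_zero_eq)
  then have "h = (\<Sum>i\<le>0. smult c (F a i))" by (simp add: F_def)
  then show ?case by (intro exI[of _ "\<lambda>_. c"])
next
  case (Suc n)
  define c where "c = coeff h (Suc n)"
  have "degree (h - smult c (F a (Suc n))) \<le> n"
  proof (rule degree_le, intro allI impI)
    fix i assume "i > n"
    show "coeff (h - smult c (F a (Suc n))) i = 0"
    proof (cases "i = Suc n")
      case True
      then show ?thesis using lead_coeff_F[of a "Suc n"] by (simp add: c_def degree_F)
    next
      case False
      with \<open>i > n\<close> Suc.prems show ?thesis by (simp add: coeff_eq_0 degree_F)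
    qed
  qed
  from Suc.IH[OF this] obtain b
    where b: "h - smult c (F a (Suc n)) = (\<Sum>i\<le>n. smult (b i) (F a i))" by blast
  have "(\<Sum>i\<le>n. smult ((b(Suc n := c)) i) (F a i)) = (\<Sum>i\<le>n. smult (b i) (F a i))"
    by (intro sum.cong) auto
  then have "h = (\<Sum>i\<le>Suc n. smult ((b(Suc n := c)) i) (F a i))"
    unfolding sum.atMost_Suc using b by (simp add: algebra_simps)
  then show ?case by blast
qed

subsection \<open>Orderings and factorials\<close>

text \<open>The local factor of n!_S along an explicit ordering, in contrast to the chosen one in
  \<open>local_fact\<close>; this form allows two orderings to be compared.\<close>

definition pfact :: "int \<Rightarrow> (nat \<Rightarrow> int) \<Rightarrow> nat \<Rightarrow> int" where
  "pfact p u n = w p (poly (F u n) (u n))"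

lemma p_ordering_mem: "p_ordering S p u \<Longrightarrow> u n \<in> S"
  by (simp add: p_ordering_def)

lemma pfact_dvd_w:
  assumes "p_ordering S p u" "s \<in> S"
  shows "pfact p u n dvd w p (poly (F u n) s)"
proof (cases "n = 0")
  case True
  then show ?thesis by (simp add: pfact_def F_def)
next
  case False
  with assms show ?thesis by (auto simp: pfact_def p_ordering_def poly_F)
qed

lemma pfact_nonneg: "prime p \<Longrightarrow> 0 \<le> pfact p u n"
  by (simp add: pfact_def w_nonneg)

text \<open>At u_i the terms with j > i vanish and those with j < i are divisible by induction,
  which leaves b_i F_i(u_i). Conversely, by minimality \<open>pfact p u i\<close> divides
  w_p(F_i(s)) for all s in S.\<close>

lemma dvd_values_iff:
  assumes p: "prime p" and u: "p_ordering S p u" and M: "prime_power_or_0 p M"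
  shows "(\<forall>s\<in>S. M dvd poly (\<Sum>i\<le>n. smult (b i) (F u i)) s) \<longleftrightarrow>
    (\<forall>i\<le>n. M dvd b i * pfact p u i)"
proof
  have step: "M dvd b i * poly (F u i) s" if "M dvd b i * pfact p u i" "s \<in> S" for i s
    using dvd_mult_w_iff[OF p M] that pfact_dvd_w[OF u, of s i]
    by (meson dvd_trans dvd_mult_cancel_left mult_dvd_mono dvd_refl)
  {
    assume "\<forall>i\<le>n. M dvd b i * pfact p u i"
    then show "\<forall>s\<in>S. M dvd poly (\<Sum>i\<le>n. smult (b i) (F u i)) s"
      unfolding poly_sum_F by (auto intro!: dvd_sum step)
  next
    assume *: "\<forall>s\<in>S. M dvd poly (\<Sum>i\<le>n. smult (b i) (F u i)) s"
    have "M dvd b i * pfact p u i" if "i \<le> n" for i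
      using that
    proof (induction i rule: less_induct)
      case (less i)
      have zero: "poly (F u j) (u i) = 0" if "i < j" for j
        using that by (auto simp: poly_F)
      have "M dvd (\<Sum>j\<le>n. b j * poly (F u j) (u i))"
        using * p_ordering_mem[OF u, of i] by (simp add: poly_sum_F)
      also have "(\<Sum>j\<le>n. b j * poly (F u j) (u i)) = (\<Sum>j\<le>i. b j * poly (F u j) (u i))"
        using less.prems by (intro sum.mono_neutral_right) (auto simp: zero)
      also have "\<dots> = (\<Sum>j<i. b j * poly (F u j) (u i)) + b i * poly (F u i) (u i)"
        by (simp add: lessThan_Suc_atMost[symmetric])
      finally have "M dvd (\<Sum>j<i. b j * poly (F u j) (u i)) + b i * poly (F u i) (u i)" .
      moreover have "M dvd (\<Sum>j<i. b j * poly (F u j) (u i))"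
        using less by (intro dvd_sum step p_ordering_mem[OF u]) auto
      ultimately have "M dvd b i * poly (F u i) (u i)"
        by (simp add: dvd_add_right_iff)
      then show ?case
        by (simp add: pfact_def dvd_mult_w_iff[OF p M])
    qed
    then show "\<forall>i\<le>n. M dvd b i * pfact p u i" by blast
  }
qed

text \<open>The polynomial \<open>F v n\<close> is monic, so its top coefficient in the basis \<open>F u i\<close> is \<open>1\<close>.\<close>

lemma pfact_unique:
  assumes p: "prime p" and u: "p_ordering S p u" and v: "p_ordering S p v"
  shows "pfact p u n = pfact p v n"
proof -
  have "pfact p v n dvd pfact p u n" if u: "p_ordering S p u" and v: "p_ordering S p v"
    for u v
  proof -
    obtain b where b: "F v n = (\<Sum>i\<le>n. smult (b i) (F u i))"
      using F_expansion[of "F v n" n u] by (auto simp: degree_F)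
    \<comment> \<open>The modulus is \<open>pfact p v n\<close> itself, which is 0 once a finite S
      is exhausted; this is where the modulus 0 matters.\<close>
    have "\<forall>s\<in>S. pfact p v n dvd poly (F v n) s"
      using pfact_dvd_w[OF v] w_dvd dvd_trans by blast
    then have "\<forall>i\<le>n. pfact p v n dvd b i * pfact p u i"
      unfolding b using dvd_values_iff[OF p u] prime_power_or_0_w pfact_def by metis
    moreover have "b n = 1"
      using coeff_sum_F[of b u n] lead_coeff_F[of v n] by (simp add: b[symmetric] degree_F)
    ultimately show ?thesis by auto
  qed
  from this[OF u v] this[OF v u] show ?thesis
    using pfact_nonneg[OF p] by (meson zdvd_antisym_nonneg)
qed

text \<open>F_m divides F_n, and by minimality the value of F_m at u_n has at least the p-part of
  m!_S.\<close>

lemma pfact_mono: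
  assumes p: "prime p" and u: "p_ordering S p u" and "m \<le> n"
  shows "pfact p u m dvd pfact p u n"
proof -
  have "poly (F u m) (u n) dvd poly (F u n) (u n)"
    unfolding poly_F using assms(3) by (intro prod_dvd_prod_subset) auto
  then show ?thesis
    using pfact_dvd_w[OF u p_ordering_mem[OF u]] w_dvd_w[OF p] dvd_trans unfolding pfact_def by blast
qed

text \<open>The terms are chosen greedily. The condition on u_n involves only earlier terms, so
  dependent choice applies.\<close>

lemma p_ordering_exists:
  assumes p: "prime p" and S: "S \<noteq> {}"
  shows "\<exists>u. p_ordering S p u"
proof -
  define P where "P u n s \<longleftrightarrow> s \<in> S \<and> (\<forall>t\<in>S. w p (\<Prod>i<n. s - u i) dvd w p (\<Prod>i<n. t - u i))"
    for u :: "nat \<Rightarrow> int" and n s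
  have "\<exists>s. P u n s" for u n
  proof -
    define v where "v s = (\<Prod>i<n. s - u i)" for s
    show ?thesis
    proof (cases "\<forall>s\<in>S. v s = 0")
      \<comment> \<open>Here the earlier terms already cover S, and every element of S attains the
        only value 0.\<close>
      case True
      then show ?thesis using S by (auto simp: P_def v_def[symmetric])
    next
      case False
      then obtain s0 where "s0 \<in> S \<and> v s0 \<noteq> 0" by blast
      \<comment> \<open>The value 0 is a multiple of everything, so it suffices to minimize over the
        nonzero values.\<close>
      obtain s where s: "s \<in> S" "v s \<noteq> 0"
        "\<And>t. t \<in> S \<Longrightarrow> v t \<noteq> 0 \<Longrightarrow> multiplicity p (v s) \<le> multiplicity p (v t)"
        using ex_has_least_nat[of "\<lambda>s. s \<in> S \<and> v s \<noteq> 0" s0 "\<lambda>s. multiplicity p (v s)"]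
          \<open>s0 \<in> S \<and> v s0 \<noteq> 0\<close> by blast
      have "w p (v s) dvd w p (v t)" if "t \<in> S" for t
        using s that by (auto simp: w_def intro!: le_imp_power_dvd)
      with s(1) show ?thesis by (auto simp: P_def v_def)
    qed
  qed
  moreover have "P u n s = P v n s" if "\<And>i. i < n \<Longrightarrow> u i = v i" for u v n s
  proof -
    have "(\<Prod>i<n. t - u i) = (\<Prod>i<n. t - v i)" for t
      using that by (intro prod.cong) auto
    then show ?thesis by (simp add: P_def)
  qed
  ultimately obtain u where "\<forall>n. P u n (u n)"
    using dependent_wellorder_choice[of P] by blast
  then show ?thesis by (auto simp: p_ordering_def P_def)
qed

section \<open>From local factors to the factorial over all primes\<close>

lemma local_fact_eq:
  assumes "prime p" "p_ordering S p u"
  shows "local_fact S p n = pfact p u n"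
proof -
  have "p_ordering S p (SOME u. p_ordering S p u)"
    using assms(2) by (rule someI[of "p_ordering S p"])
  from pfact_unique[OF assms(1) this assms(2)] show ?thesis
    by (simp add: local_fact_def Let_def pfact_def poly_F)
qed

text \<open>Pigeonhole: the first n terms of a p-ordering meet at most n of the n+1 residue classes
  of the u_j, so F_n(u_j) is prime to p for some j, and minimality makes the local factor 1.\<close>

lemma local_fact_eq_1:
  assumes p: "prime p" and S: "u ` {..n} \<subseteq> S"
    and inc: "\<And>i j. i \<le> n \<Longrightarrow> j \<le> n \<Longrightarrow> i \<noteq> j \<Longrightarrow> \<not> p dvd u i - u j"
  shows "local_fact S p n = 1"
proof -
  have "S \<noteq> {}" using S by auto
  then obtain v where v: "p_ordering S p v" using p_ordering_exists[OF p] by blast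
  have "inj_on (\<lambda>i. u i mod p) {..n}"
    using inc by (auto simp: inj_on_def mod_eq_dvd_iff)
  then have "card ((\<lambda>i. u i mod p) ` {..n}) = Suc n" by (simp add: card_image)
  moreover have "card ((\<lambda>i. v i mod p) ` {..<n}) \<le> n"
    using card_image_le[of "{..<n}"] by simp
  ultimately have "\<not> (\<lambda>i. u i mod p) ` {..n} \<subseteq> (\<lambda>i. v i mod p) ` {..<n}"
    using card_mono[of "(\<lambda>i. v i mod p) ` {..<n}" "(\<lambda>i. u i mod p) ` {..n}"] by fastforce
  then obtain j where j: "j \<le> n" "u j mod p \<notin> (\<lambda>i. v i mod p) ` {..<n}" by auto
  have "\<not> p dvd (\<Prod>i<n. u j - v i)"
    using j(2) p by (auto simp: prime_dvd_prod_iff mod_eq_dvd_iff[symmetric])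
  then have "w p (poly (F v n) (u j)) = 1"
    by (auto simp del: prod_zero_iff simp: w_def poly_F not_dvd_imp_multiplicity_0)
  moreover have "u j \<in> S" using S j by auto
  ultimately have "pfact p v n dvd 1"
    using pfact_dvd_w[OF v, of "u j" n] by simp
  then show ?thesis
    using pfact_nonneg[OF p, of v n] local_fact_eq[OF p v] by (simp add: zdvd1_eq)
qed

text \<open>Nonvanishing at one prime p makes the first n+1 terms of a p-ordering distinct. A prime
  q dividing none of their differences has local factor 1.\<close>

lemma finite_local_fact_neq_1:
  assumes S: "S \<noteq> {}" and p: "prime p" and nz: "local_fact S p n \<noteq> 0"
  shows "finite {q. prime q \<and> local_fact S q n \<noteq> 1}"
proof -
  obtain u where u: "p_ordering S p u" using p_ordering_exists[OF p S] by blast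
  have distinct: "u i \<noteq> u j" if "i < j" "j \<le> n" for i j
  proof
    assume "u i = u j"
    then have "pfact p u j = 0"
      using that p by (auto simp: pfact_def poly_F w_eq_0_iff intro!: bexI[of _ i])
    then have "pfact p u n = 0"
      using pfact_mono[OF p u that(2)] by simp
    with nz local_fact_eq[OF p u] show False by simp
  qed
  define N where "N = (\<Prod>i\<le>n. \<Prod>j\<in>{..n} - {i}. u i - u j)"
  have "N \<noteq> 0"
    using distinct by (auto simp: N_def) (metis linorder_neqE_nat)
  have "q dvd N" if q: "prime q" "local_fact S q n \<noteq> 1" for q
  proof -
    from local_fact_eq_1[OF q(1), of u n S] q(2) p_ordering_mem[OF u]
    obtain i j where ij: "i \<le> n" "j \<le> n" "i \<noteq> j" "q dvd u i - u j" by blast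
    then have "q dvd (\<Prod>j\<in>{..n} - {i}. u i - u j)"
      by (intro dvd_trans[OF ij(4)] dvd_prodI) auto
    then show ?thesis
      unfolding N_def using ij by (meson dvd_trans dvd_prodI finite_atMost atMost_iff)
  qed
  then have "{q. prime q \<and> local_fact S q n \<noteq> 1} \<subseteq> {q. q dvd N}" by blast
  with finite_divisors_int[OF \<open>N \<noteq> 0\<close>] show ?thesis by (meson finite_subset)
qed

text \<open>A local factor vanishing at n would also vanish at k. Hence n!_S is a finite product of
  powers of distinct primes, and its p-part can be read off.\<close>

lemma w_gen_fact:
  assumes S: "S \<noteq> {}" and nz: "gen_fact S k \<noteq> 0" and n: "n \<le> k" and p: "prime p"
    and u: "p_ordering S p u"
  shows "w p (gen_fact S n) = pfact p u n" "pfact p u n \<noteq> 0"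
proof -
  have nonzero: "local_fact S q n \<noteq> 0" if q: "prime q" for q
  proof
    assume "local_fact S q n = 0"
    obtain v where v: "p_ordering S q v" using p_ordering_exists[OF q S] by blast
    from pfact_mono[OF q v n] \<open>local_fact S q n = 0\<close> have "local_fact S q k = 0"
      by (simp add: local_fact_eq[OF q v])
    with q have "gen_fact S k = 0" unfolding gen_fact_def by (metis (full_types))
    with nz show False by blast
  qed
  show "pfact p u n \<noteq> 0" using nonzero[OF p] local_fact_eq[OF p u] by simp
  have pow: "\<exists>m. local_fact S q n = q ^ m" if q: "prime q" for q
  proof -
    obtain v where v: "p_ordering S q v" using p_ordering_exists[OF q S] by blast
    show ?thesis using nonzero[OF q] prime_power_or_0_w[of q]
      unfolding local_fact_eq[OF q v] pfact_def prime_power_or_0_def by blast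
  qed
  define e where "e q = (SOME m. local_fact S q n = q ^ m)" for q
  have e: "local_fact S q n = q ^ e q" if "prime q" for q
    unfolding e_def using pow[OF that] by (rule someI_ex)
  define Q where "Q = {q. prime q \<and> local_fact S q n \<noteq> 1}"
  have Q: "finite Q" "\<And>q. q \<in> Q \<Longrightarrow> prime q"
    using finite_local_fact_neq_1[OF S p nonzero[OF p]] by (auto simp: Q_def)
  have "gen_fact S n = (\<Prod>q\<in>Q. q ^ e q)"
    using nonzero by (auto simp: gen_fact_def Q_def e intro!: prod.cong)
  moreover have "(\<Prod>q\<in>Q. q ^ e q) \<noteq> 0"
    using Q by (auto simp: prod_zero_iff dest: prime_gt_0_int)
  moreover have "multiplicity p (\<Prod>q\<in>Q. q ^ e q) = (if p \<in> Q then e p else 0)"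
    using Q p by (intro multiplicity_prod_prime_powers) auto
  moreover have "local_fact S p n = 1" if "p \<notin> Q"
    using that p by (simp add: Q_def)
  ultimately have "w p (gen_fact S n) = local_fact S p n"
    by (auto simp: w_def e[OF p])
  then show "w p (gen_fact S n) = pfact p u n" by (simp add: local_fact_eq[OF p u])
qed

text \<open>Terms of a d_k-ordering need not lie in S. As F_0, ..., F_n involve only a_0, ...,
  a_(n-1), congruence of these to a p-ordering transfers \<open>dvd_values_iff\<close>.\<close>

lemma dvd_values_iff_cong:
  assumes p: "prime p" and u: "p_ordering S p u" and "m \<le> e"
    and a: "\<And>i. i < n \<Longrightarrow> [a i = u i] (mod p ^ e)"
  shows "(\<forall>s\<in>S. p ^ m dvd poly (\<Sum>i\<le>n. smult (b i) (F a i)) s) \<longleftrightarrow>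
    (\<forall>i\<le>n. p ^ m dvd b i * pfact p u i)"
proof -
  have "[a i = u i] (mod p ^ m)" if "i < n" for i
    using a[OF that] le_imp_power_dvd[OF \<open>m \<le> e\<close>] by (rule cong_dvd_modulus)
  then have "[poly (\<Sum>i\<le>n. smult (b i) (F a i)) s = poly (\<Sum>i\<le>n. smult (b i) (F u i)) s] (mod p ^ m)" for s
    unfolding poly_sum_F by (intro cong_sum cong_mult cong_refl poly_F_cong) auto
  then show ?thesis
    unfolding dvd_values_iff[OF p u prime_power_or_0_power, symmetric]
    by (intro ball_cong refl cong_dvd_iff)
qed

text \<open>Serves to bound the p-part of d by that of k!_S. Replacing each
  \<open>pfact p u i\<close> by its multiple \<open>pfact p u k\<close> shows that p^m divides every
  coefficient of \<open>smult (pfact p u k) g\<close>, whose content is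
  \<open>pfact p u k\<close>.\<close>

lemma primitive_values_dvd_pfact:
  assumes p: "prime p" and u: "p_ordering S p u" and g: "content g = 1" "degree g \<le> k"
    and dvd: "\<And>s. s \<in> S \<Longrightarrow> p ^ m dvd poly g s"
  shows "p ^ m dvd pfact p u k"
proof -
  obtain b where b: "g = (\<Sum>i\<le>k. smult (b i) (F u i))"
    using F_expansion[OF g(2)] by blast
  have *: "p ^ m dvd b i * pfact p u k" if "i \<le> k" for i
  proof -
    have "p ^ m dvd b i * pfact p u i"
      using dvd_values_iff[OF p u prime_power_or_0_power] dvd that unfolding b by blast
    then show ?thesis
      using pfact_mono[OF p u that] by (meson dvd_trans mult_dvd_mono dvd_refl)
  qed
  have "smult (pfact p u k) g = (\<Sum>i\<le>k. smult (b i * pfact p u k) (F u i))"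
    by (simp add: b poly_eq_iff coeff_sum sum_distrib_left mult_ac)
  also have "[:p ^ m:] dvd \<dots>"
    using * by (intro dvd_sum) (auto simp: const_poly_dvd_iff)
  finally have "p ^ m dvd content (smult (pfact p u k) g)"
    by (simp only: const_poly_dvd_iff_dvd_content)
  then show ?thesis by (simp add: g)
qed

subsection \<open>Splitting a prime power between two factors\<close>

lemma prime_power_dvd_cofactor:
  fixes p :: int
  assumes p: "prime p" and h: "p ^ y dvd h" "\<not> p ^ Suc y dvd h" and "y \<le> D"
    and prod: "p ^ D dvd h * h'"
  shows "p ^ (D - y) dvd h'"
proof -
  obtain q where q: "h = p ^ y * q" using h(1) by (elim dvdE)
  have "\<not> p dvd q" using h(2) by (auto simp: q)
  have "p ^ y * p ^ (D - y) dvd p ^ y * (q * h')"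
    using prod \<open>y \<le> D\<close> by (simp add: q mult.assoc power_add[symmetric])
  then have "p ^ (D - y) dvd q * h'" using p by simp
  with coprime_prime_power[OF p \<open>\<not> p dvd q\<close>] show ?thesis
    by (simp only: coprime_dvd_mult_right_iff)
qed

text \<open>The valuation y of c is below x, so \<open>h1\<close>, being congruent to c modulo p^x,
  has valuation exactly y on all of S. The other factor must then supply the remaining D -
  y.\<close>

lemma split_at_constant_valuation:
  fixes p :: int
  assumes p: "prime p" and h1: "\<And>s. s \<in> S \<Longrightarrow> p ^ x dvd h1 s - c" and c: "\<not> p ^ x dvd c"
    and prod: "\<And>s. s \<in> S \<Longrightarrow> p ^ D dvd h1 s * h2 s" and "x \<le> D"
  shows "\<exists>y\<le>D. \<forall>s\<in>S. p ^ y dvd h1 s \<and> p ^ (D - y) dvd h2 s"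
proof -
  define y where "y = multiplicity p c"
  have "c \<noteq> 0" using c by auto
  then have pow: "p ^ n dvd c \<longleftrightarrow> n \<le> y" for n
    unfolding y_def using \<open>c \<noteq> 0\<close> p not_prime_unit by (intro power_dvd_iff_le_multiplicity) auto
  have "y < x" using c pow by simp
  have same: "p ^ n dvd h1 s \<longleftrightarrow> p ^ n dvd c" if "n \<le> x" "s \<in> S" for n s
  proof -
    have "p ^ n dvd h1 s - c"
      using h1[OF that(2)] le_imp_power_dvd[OF that(1)] dvd_trans by blast
    then show ?thesis using dvd_diff_right_iff dvd_add_right_iff[of "p ^ n" "h1 s - c" c] by simp
  qed
  have "p ^ y dvd h1 s \<and> p ^ (D - y) dvd h2 s" if s: "s \<in> S" for s
  proof -
    have "p ^ y dvd h1 s" "\<not> p ^ Suc y dvd h1 s"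
      using same[OF _ s, of y] same[OF _ s, of "Suc y"] \<open>y < x\<close> pow[of y] pow[of "Suc y"] by auto
    then show ?thesis
      using prime_power_dvd_cofactor[OF p _ _ _ prod[OF s]] \<open>y < x\<close> \<open>x \<le> D\<close> by auto
  qed
  then show ?thesis using \<open>y < x\<close> \<open>x \<le> D\<close> by (intro exI[of _ y]) auto
qed

text \<open>The nonconstant terms are balanced first: with x the largest exponent up to D available
  in all of those of \<open>g1\<close>, the condition on pairs forces D - x on those of
  \<open>g2\<close>. Then only the constants b_0 and c_0 can interfere.\<close>

lemma values_split:
  assumes p: "prime p" and u: "p_ordering S p u" and "D \<le> e"
    and a: "\<And>i. i < max k1 k2 \<Longrightarrow> [a i = u i] (mod p ^ e)"
    and coeffs: "\<And>r s. 1 \<le> r \<Longrightarrow> r \<le> k1 \<Longrightarrow> 1 \<le> s \<Longrightarrow> s \<le> k2 \<Longrightarrow>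
      p ^ D dvd (b r * pfact p u r) * (c s * pfact p u s)"
    and g1: "g1 = (\<Sum>i\<le>k1. smult (b i) (F a i))" and g2: "g2 = (\<Sum>i\<le>k2. smult (c i) (F a i))"
    and prod: "\<And>s. s \<in> S \<Longrightarrow> p ^ D dvd poly g1 s * poly g2 s"
  shows "\<exists>y\<le>D. \<forall>s\<in>S. p ^ y dvd poly g1 s \<and> p ^ (D - y) dvd poly g2 s"
proof -
  define B where "B x \<longleftrightarrow> x \<le> D \<and> (\<forall>r\<in>{1..k1}. p ^ x dvd b r * pfact p u r)" for x
  have "B 0" by (simp add: B_def)
  moreover have bounded: "B x \<Longrightarrow> x \<le> D" for x by (simp add: B_def)
  ultimately obtain x where x: "B x" and max: "\<And>y. B y \<Longrightarrow> y \<le> x"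
    using GreatestI_nat[of B 0 D] Greatest_le_nat[of B _ D] by blast
  \<comment> \<open>If x = D, as happens for k1 = 0, the modulus is 1. Otherwise some index r fails
    at x + 1, so its term has valuation exactly x.\<close>
  have c: "p ^ (D - x) dvd c s * pfact p u s" if s: "s \<in> {1..k2}" for s
  proof (cases "x = D")
    case False
    then obtain r where r: "r \<in> {1..k1}" "\<not> p ^ Suc x dvd b r * pfact p u r"
      using max[of "Suc x"] x unfolding B_def by (metis Suc_leI le_neq_implies_less not_less_eq_eq order_refl)
    moreover have "p ^ x dvd b r * pfact p u r" using x r by (simp add: B_def)
    ultimately show ?thesis
      using s coeffs[of r s] prime_power_dvd_cofactor[OF p] bounded[OF x] by simp
  qed simp
  \<comment> \<open>\<open>b(0 := 0)\<close> removes the term about which nothing is assumed; since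
    F_0 = 1, it is the constant b_0.\<close>
  have near_constant: "p ^ m dvd poly (\<Sum>i\<le>n. smult (b i) (F a i)) s - b 0"
    if "m \<le> D" "n \<le> max k1 k2" "\<And>r. r \<in> {1..n} \<Longrightarrow> p ^ m dvd b r * pfact p u r" "s \<in> S"
    for m n s and b :: "nat \<Rightarrow> int"
  proof -
    have "\<forall>i\<le>n. p ^ m dvd (b(0 := 0)) i * pfact p u i" using that by auto
    moreover have "m \<le> e" "\<And>i. i < n \<Longrightarrow> [a i = u i] (mod p ^ e)"
      using that \<open>D \<le> e\<close> a by auto
    ultimately have "p ^ m dvd poly (\<Sum>i\<le>n. smult ((b(0 := 0)) i) (F a i)) s"
      using dvd_values_iff_cong[OF p u, of m e n a "b(0 := 0)"] that(4) by blast
    moreover have "(\<Sum>i\<le>n. smult (b i) (F a i)) = (\<Sum>i\<le>n. smult ((b(0 := 0)) i) (F a i)) + [:b 0:]"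
      by (subst (1 2) sum.atMost_shift) (simp add: F_def)
    ultimately show ?thesis by simp
  qed
  have x1: "p ^ x dvd poly g1 s - b 0" if "s \<in> S" for s
    unfolding g1 using x that by (intro near_constant) (auto simp: B_def)
  have x2: "p ^ (D - x) dvd poly g2 s - c 0" if "s \<in> S" for s
    unfolding g2 using c that by (intro near_constant) auto
  \<comment> \<open>A constant of too small valuation forces constant valuation on its factor;
    otherwise D = x + (D - x) is already a valid split.\<close>
  consider "\<not> p ^ x dvd b 0" | "\<not> p ^ (D - x) dvd c 0" | "p ^ x dvd b 0" "p ^ (D - x) dvd c 0" by blast
  then show ?thesis
  proof cases
    case 1
    show ?thesis
      by (rule split_at_constant_valuation[of p S x "poly g1" "b 0" D "poly g2",
            OF p x1 1 prod bounded[OF x]])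
  next
    case 2
    have "p ^ D dvd poly g2 s * poly g1 s" if "s \<in> S" for s
      using prod[OF that] by (simp add: mult.commute)
    from split_at_constant_valuation[of p S "D - x" "poly g2" "c 0" D "poly g1", OF p x2 2 this] obtain y
      where y: "y \<le> D" "\<forall>s\<in>S. p ^ y dvd poly g2 s \<and> p ^ (D - y) dvd poly g1 s" by auto
    then show ?thesis by (intro exI[of _ "D - y"]) (auto simp: diff_diff_cancel)
  next
    case 3
    then have "p ^ x dvd poly g1 s \<and> p ^ (D - x) dvd poly g2 s" if "s \<in> S" for s
      using x1[OF that] x2[OF that] dvd_add[of "p ^ x" "poly g1 s - b 0" "b 0"]
        dvd_add[of "p ^ (D - x)" "poly g2 s - c 0" "c 0"] that by simp
    then show ?thesis using bounded[OF x] by blast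
  qed
qed

subsection \<open>The divisibility condition on the coefficients\<close>

lemma mu_eq:
  assumes "prime p" "w p (gen_fact S i) = p ^ x" "w p d = p ^ D" "x \<le> D"
  shows "mu S i d p = p ^ (D - x)"
  unfolding mu_def
proof (rule the_equality)
  show "(\<exists>e. p ^ (D - x) = p ^ e) \<and> p ^ (D - x) * w p (gen_fact S i) = w p d"
    using assms by (auto simp: power_add[symmetric])
next
  fix m assume "(\<exists>e. m = p ^ e) \<and> m * w p (gen_fact S i) = w p d"
  then have "m * p ^ x = p ^ (D - x) * p ^ x"
    using assms by (auto simp: power_add[symmetric])
  then show "m = p ^ (D - x)" using assms(1) by simp
qed

text \<open>The quotient is p^(D-x-y), whose exponent may be negative; clearing denominators leaves
  an integer divisibility. The convention \<open>w p 0 = 0\<close> fits, as both sides hold for n =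
  0.\<close>

lemma rat_divides_iff:
  assumes p: "prime p" and "x \<le> D" "y \<le> D"
  shows "rat_divides (of_int (p ^ (D - x)) * of_int (p ^ (D - y)) / of_int (p ^ D)) (of_int (w p n)) \<longleftrightarrow>
    p ^ D dvd n * (p ^ x * p ^ y)"
proof -
  have p0: "(of_int p :: rat) \<noteq> 0" using p by auto
  have diff: "of_int (p ^ (D - i)) = (of_int p ^ D / of_int p ^ i :: rat)" if "i \<le> D" for i
    unfolding of_int_power using p0 that by (rule power_diff)
  have "(of_int (w p n) :: rat) = of_int (p ^ (D - x)) * of_int (p ^ (D - y)) / of_int (p ^ D) * of_int m \<longleftrightarrow>
      (p ^ x * p ^ y) * w p n = p ^ D * m" for m
  proof -
    have "(of_int (w p n) :: rat) = of_int (p ^ (D - x)) * of_int (p ^ (D - y)) / of_int (p ^ D) * of_int m \<longleftrightarrow>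
      of_int ((p ^ x * p ^ y) * w p n) = (of_int (p ^ D * m) :: rat)"
      unfolding diff[OF assms(2)] diff[OF assms(3)] using p0
      by (simp add: field_simps)
    then show ?thesis by (simp only: of_int_eq_iff)
  qed
  then have "rat_divides (of_int (p ^ (D - x)) * of_int (p ^ (D - y)) / of_int (p ^ D)) (of_int (w p n)) \<longleftrightarrow>
      p ^ D dvd (p ^ x * p ^ y) * w p n"
    unfolding rat_divides_def dvd_def by simp
  also have "\<dots> \<longleftrightarrow> p ^ D dvd n * (p ^ x * p ^ y)"
    using dvd_mult_w_iff[OF p prime_power_or_0_power, of D "p ^ x * p ^ y" n] by (simp add: mult.commute)
  finally show ?thesis .
qed

text \<open>If x or y exceeds D, \<open>mu\<close> is meaningless. The size conditions then make the
  left side false, and the right side is false because p^x or p^y already contains p^D.\<close>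

lemma rat_divides_mu_iff:
  assumes p: "prime p" and r: "w p (gen_fact S r) = p ^ x" and s: "w p (gen_fact S s) = p ^ y"
    and d: "w p d = p ^ D"
  shows "w p (gen_fact S r) \<le> w p d \<and> w p (gen_fact S s) \<le> w p d \<and>
      \<not> rat_divides (of_int (mu S r d p) * of_int (mu S s d p) / of_int (w p d)) (of_int (w p (m * n))) \<longleftrightarrow>
    \<not> p ^ D dvd (m * p ^ x) * (n * p ^ y)"
proof (cases "x \<le> D \<and> y \<le> D")
  case True
  have "p ^ x \<le> p ^ D" "p ^ y \<le> p ^ D"
    using True prime_ge_1_int[OF p] by (auto intro: power_increasing)
  then show ?thesis
    using True rat_divides_iff[OF p, of x D y "m * n"]
    by (simp add: mu_eq[OF p r d] mu_eq[OF p s d] r s d mult_ac)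
next
  case False
  then have "p ^ D dvd p ^ x \<or> p ^ D dvd p ^ y"
    by (auto intro: le_imp_power_dvd)
  then have "p ^ D dvd (m * p ^ x) * (n * p ^ y)"
    by (auto intro: dvd_mult dvd_mult2)
  moreover have "\<not> (p ^ x \<le> p ^ D \<and> p ^ y \<le> p ^ D)"
    using False prime_gt_1_int[OF p] by (simp add: power_increasing_iff)
  ultimately show ?thesis unfolding r s d by blast
qed

subsection \<open>Factorizations in the ring of integer-valued polynomials\<close>

lemma poly_map_of_int: "poly (map_poly of_int g) (of_int s) = (of_int (poly g s) :: 'a :: comm_ring_1)"
  by (induction g) (simp_all add: map_poly_pCons)

lemma map_of_int_mult:
  "map_poly of_int (g * h) = (map_poly of_int g * map_poly of_int h :: 'a :: comm_ring_1 poly)"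
  by (intro poly_eqI) (simp add: coeff_map_poly coeff_mult)

lemma map_of_int_smult:
  "map_poly of_int (smult c g) = (smult (of_int c) (map_poly of_int g) :: 'a :: comm_ring_1 poly)"
  by (intro poly_eqI) (simp add: coeff_map_poly)

lemma map_of_int_eq_iff:
  "map_poly of_int g = (map_poly of_int h :: 'a :: ring_char_0 poly) \<longleftrightarrow> g = h"
  by (auto simp: poly_eq_iff coeff_map_poly)

lemma degree_map_of_int: "degree (map_poly of_int g :: 'a :: ring_char_0 poly) = degree g"
  by (cases "g = 0") (auto intro!: map_poly_degree_eq)

text \<open>After clearing denominators, the content of the numerator is split off and reduced
  against the common denominator, so that lowest terms become a matter of two integers.\<close>

lemma reduced_fraction_exists: "\<exists>g d. reduced_fraction h g d"
proof (cases "h = 0")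
  case True
  then show ?thesis by (intro exI[of _ 0] exI[of _ 1]) (simp add: reduced_fraction_def)
next
  case False
  have "\<exists>D G. D > 0 \<and> smult (of_int D) h = map_poly of_int G"
  proof (induction h)
    case (pCons a h)
    then obtain D G where D: "D > 0" "smult (of_int D) h = map_poly of_int G" by blast
    obtain n m where nm: "quotient_of a = (n, m)" by fastforce
    have m: "m > 0" "a = of_int n / of_int m"
      using nm quotient_of_denom_pos quotient_of_div by auto
    have "smult (of_int (D * m)) (pCons a h) =
        pCons (of_int (D * n)) (smult (of_int m) (smult (of_int D) h))"
      using m by (simp add: mult_ac)
    also have "\<dots> = map_poly of_int (pCons (D * n) (smult m G))"
      unfolding D(2) by (simp add: map_poly_pCons map_of_int_smult)
    finally show ?case using m(1) D(1) by (metis mult_pos_pos)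
  qed (auto intro: exI[of _ 1] exI[of _ 0])
  then obtain D G where D: "D > 0" "smult (of_int D) h = map_poly of_int G" by blast
  obtain x y where xy: "quotient_of (of_int (content G) / of_int D) = (x, y)" by fastforce
  have y: "y > 0" "coprime x y" "of_int (content G) / of_int D = (of_int x / of_int y :: rat)"
    using xy quotient_of_denom_pos quotient_of_div quotient_of_coprime by blast+
  have "G \<noteq> 0" using False D by auto
  have "h = smult (1 / of_int D) (smult (of_int D) h)" using D(1) by simp
  also have "\<dots> = smult (1 / of_int D) (map_poly of_int (smult (content G) (primitive_part G)))"
    unfolding D(2) by simp
  also have "\<dots> = smult (of_int (content G) / of_int D) (map_poly of_int (primitive_part G))"
    by (simp only: map_of_int_smult) simp
  also have "\<dots> = smult (1 / of_int y) (map_poly of_int (smult x (primitive_part G)))"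
    unfolding y(3) by (simp add: map_of_int_smult)
  finally have "h = smult (1 / of_int y) (map_poly of_int (smult x (primitive_part G)))" .
  moreover have "coprime (content (smult x (primitive_part G))) y"
    using y(2) \<open>G \<noteq> 0\<close> by (simp add: content_smult)
  ultimately have "reduced_fraction h (smult x (primitive_part G)) y"
    using y(1) by (simp only: reduced_fraction_def simp_thms)
  then show ?thesis by blast
qed

section \<open>Values of reduced fractions and image primitivity\<close>

lemma reduced_fraction_values:
  assumes "reduced_fraction f g d" "f \<in> Int_poly S" "s \<in> S"
  shows "\<exists>n. poly f (of_int s) = of_int n \<and> poly g s = d * n"
proof -
  obtain n where n: "poly f (of_int s) = of_int n"
    using assms by (auto simp: Int_poly_def elim: Ints_cases)
  have "d > 0" and "poly f (of_int s) = of_int (poly g s) / of_int d"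
    using assms(1) by (auto simp: reduced_fraction_def poly_map_of_int)
  then have "(of_int (poly g s) :: rat) = of_int (d * n)" by (simp add: n field_simps)
  then show ?thesis using n by (simp only: of_int_eq_iff) blast
qed

text \<open>Over the empty set every prime would vacuously divide all values.\<close>

lemma image_primitive_nonempty:
  assumes "image_primitive S f"
  shows "S \<noteq> {}"
proof
  assume "S = {}"
  moreover note assms
  moreover have "prime (2 :: int)" by simp
  ultimately show False unfolding image_primitive_def by blast
qed

text \<open>A prime dividing the content of g is prime to d by lowest terms, so it would survive in
  every value of g/d.\<close>

lemma reduced_fraction_primitive:
  assumes "image_primitive S f" "reduced_fraction f g d" "g \<noteq> 0"
  shows "content g = 1"
proof (rule ccontr)
  assume "content g \<noteq> 1"
  then obtain p where p: "prime p" "p dvd content g"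
    using prime_divisor_exists[of "content g"] assms(3) by (auto simp del: zdvd1_eq)
  have f: "f \<in> Int_poly S" using assms(1) by (simp add: image_primitive_def)
  have "\<not> p dvd d"
    using assms(2) p not_prime_unit coprime_common_divisor by (auto simp: reduced_fraction_def)
  have "\<exists>m. poly f (of_int s) = of_int (p * m)" if s: "s \<in> S" for s
  proof -
    obtain n where n: "poly f (of_int s) = of_int n" "poly g s = d * n"
      using reduced_fraction_values[OF assms(2) f s] by blast
    obtain h where "g = smult p h"
      using p(2) by (auto simp: const_poly_dvd_iff_dvd_content[symmetric] elim!: dvdE)
    then have "p dvd d * n" using n(2) by (metis dvd_triv_left poly_smult)
    with p(1) \<open>\<not> p dvd d\<close> have "p dvd n" by (simp add: prime_dvd_mult_iff)
    with n(1) show ?thesis by (auto elim!: dvdE)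
  qed
  with assms(1) p(1) show False unfolding image_primitive_def by blast
qed

lemma image_primitive_factor:
  assumes "image_primitive S (f1 * f2)" "f1 \<in> Int_poly S" "f2 \<in> Int_poly S"
  shows "image_primitive S f1"
proof (rule ccontr)
  assume "\<not> image_primitive S f1"
  with assms(2) obtain p where p: "prime p" "\<forall>s\<in>S. \<exists>m. poly f1 (of_int s) = of_int (p * m)"
    by (auto simp: image_primitive_def)
  have "\<exists>m. poly (f1 * f2) (of_int s) = of_int (p * m)" if s: "s \<in> S" for s
  proof -
    obtain m n where "poly f1 (of_int s) = of_int (p * m)" "poly f2 (of_int s) = of_int n"
      using p(2) assms(3) s unfolding Int_poly_def by (blast elim: Ints_cases)
    then have "poly (f1 * f2) (of_int s) = of_int (p * (m * n))" by (simp add: mult_ac)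
    then show ?thesis by blast
  qed
  with assms(1) p(1) show False unfolding image_primitive_def by blast
qed

lemma image_primitive_const:
  assumes "image_primitive S [:q:]"
  shows "q = 1 \<or> q = -1"
proof (rule ccontr)
  assume *: "\<not> (q = 1 \<or> q = -1)"
  obtain s where "s \<in> S" using image_primitive_nonempty[OF assms] by blast
  then obtain n where n: "q = of_int n"
    using assms by (auto simp: image_primitive_def Int_poly_def elim: Ints_cases)
  obtain p where "prime p" "p dvd n"
  proof (cases "n = 0")
    case True
    then show ?thesis using that[of 2] by simp
  next
    case False
    moreover have "\<not> is_unit n" using * n by (auto simp: abs_if split: if_splits)
    ultimately show ?thesis using prime_divisor_exists that by blast
  qed
  then show False using assms n by (auto simp: image_primitive_def elim!: dvdE)
qed

text \<open>Constant factors inherit image primitivity, hence are 1 or -1 and units, while units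
  have degree 0. So only factorizations into two nonconstant polynomials count.\<close>

lemma ring_irreducible_Int_ring_iff:
  assumes prim: "image_primitive S f" and deg: "degree f \<ge> 1"
  shows "ring_irreducible\<^bsub>Int_ring S\<^esub> f \<longleftrightarrow>
    (\<forall>f1\<in>Int_poly S. \<forall>f2\<in>Int_poly S. f = f1 * f2 \<longrightarrow> degree f1 = 0 \<or> degree f2 = 0)"
proof
  have f0: "f \<noteq> 0" using deg by auto
  have sign: "c = 1 \<or> c = -1"
    if c: "c \<in> Int_poly S" "h \<in> Int_poly S" "f = c * h" "degree c = 0" for c h
  proof -
    obtain q where q: "c = [:q:]" using c(4) by (rule degree_eq_zeroE)
    have "image_primitive S c" using image_primitive_factor[OF prim[unfolded c(3)] c(1,2)] .
    with image_primitive_const[of S q] q show ?thesis by (auto simp: one_pCons)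
  qed
  have degree_unit: "degree u = 0" if u: "u \<in> Units (Int_ring S)" for u
  proof -
    obtain v where "v * u = 1" using u by (auto simp: Units_def Int_ring_def)
    then have "is_unit u" by (metis dvd_triv_right)
    then show ?thesis by (auto elim: is_unit_polyE)
  qed
  {
    assume irr: "ring_irreducible\<^bsub>Int_ring S\<^esub> f"
    show "\<forall>f1\<in>Int_poly S. \<forall>f2\<in>Int_poly S. f = f1 * f2 \<longrightarrow> degree f1 = 0 \<or> degree f2 = 0"
    proof (intro ballI impI)
      fix f1 f2 assume f12: "f1 \<in> Int_poly S" "f2 \<in> Int_poly S" "f = f1 * f2"
      show "degree f1 = 0 \<or> degree f2 = 0"
      proof (cases "f1 \<in> Units (Int_ring S)")
        case False
        \<comment> \<open>Irreducibility denies that the nonunit f1 is a proper factor, so f divides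
          it back and f2 is invertible.\<close>
        then have "\<not> properfactor (Int_ring S) f1 f"
          using irr f12 by (auto simp: ring_irreducible_def Divisibility.irreducible_def Int_ring_def)
        then obtain c where "f1 = f * c"
          using f12 by (auto simp: properfactor_def factor_def Int_ring_def)
        then have "f1 * 1 = f1 * (f2 * c)" using f12(3) by (simp add: mult.assoc)
        then have "f2 * c = 1" using f0 f12(3) by auto
        then have "is_unit f2" by (metis dvd_triv_left)
        then show ?thesis by (auto elim: is_unit_polyE)
      qed (use degree_unit in blast)
    qed
  next
    assume *: "\<forall>f1\<in>Int_poly S. \<forall>f2\<in>Int_poly S. f = f1 * f2 \<longrightarrow> degree f1 = 0 \<or> degree f2 = 0"
    have "b \<in> Units (Int_ring S)" if b: "b \<in> Int_poly S" "properfactor (Int_ring S) b f" for b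
    proof -
      obtain c where c: "c \<in> Int_poly S" "f = b * c"
        using b(2) by (auto simp: properfactor_def factor_def Int_ring_def)
      consider "degree b = 0" | "degree c = 0" using *[rule_format, OF b(1) c] by auto
      then show ?thesis
      proof cases
        case 1
        with sign[OF b(1) c] have "b * b = 1" by auto
        with b(1) show ?thesis by (auto simp: Units_def Int_ring_def)
      next
        case 2
        \<comment> \<open>The cofactor c is 1 or -1, so f divides b, contradicting that b is a
          proper factor.\<close>
        have "f = c * b" using c(2) by (simp add: mult.commute)
        from sign[OF c(1) b(1) this 2] have "b = f * c" using c(2) by auto
        then have "factor (Int_ring S) f b" using c(1) by (auto simp: factor_def Int_ring_def)
        with b(2) show ?thesis by (simp add: properfactor_def)
      qed
    qed
    then show "ring_irreducible\<^bsub>Int_ring S\<^esub> f"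
      using f0 deg degree_unit[of f]
      by (auto simp: ring_irreducible_def Divisibility.irreducible_def Int_ring_def)
  }
qed

text \<open>By Gauss' lemma, comparing contents in d1 d2 g = d g1 g2 gives d = d1 d2, all
  denominators being positive; then d cancels.\<close>

lemma reduced_fraction_mult:
  assumes "reduced_fraction (f1 * f2) g d" "reduced_fraction f1 g1 d1" "reduced_fraction f2 g2 d2"
    and "content g = 1" "content g1 = 1" "content g2 = 1"
  shows "g = g1 * g2" "d = d1 * d2"
proof -
  have pos: "d > 0" "d1 > 0" "d2 > 0" using assms by (auto simp: reduced_fraction_def)
  define R where "R = (map_poly of_int :: int poly \<Rightarrow> rat poly)"
  have eq: "smult (1 / of_int d) (R g) = smult (1 / of_int d1) (R g1) * smult (1 / of_int d2) (R g2)"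
    using assms(1-3) by (simp add: reduced_fraction_def R_def)
  have "R (smult (d1 * d2) g) = smult (of_int (d1 * d2 * d)) (smult (1 / of_int d) (R g))"
    using pos by (simp add: R_def map_of_int_smult)
  also have "\<dots> = R (smult d (g1 * g2))"
    unfolding eq using pos by (simp add: R_def map_of_int_smult map_of_int_mult)
  finally have *: "smult (d1 * d2) g = smult d (g1 * g2)"
    by (simp add: R_def map_of_int_eq_iff)
  from arg_cong[OF this, of content] show d: "d = d1 * d2"
    using pos assms(4-6) by (simp add: content_mult)
  have "smult d (g - g1 * g2) = 0" using * by (simp add: smult_diff_right d[symmetric])
  with pos show "g = g1 * g2" by simp
qed

text \<open>Factors of f inherit image primitivity, so their reduced numerators are primitive and
  multiply exactly to g. Backwards, such a split of g and d yields factors g1/d1 and g2/d2 whether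
  or not these are in lowest terms.\<close>

lemma ring_irreducible_iff_numerator:
  assumes prim: "image_primitive S f" and red: "reduced_fraction f g d" and deg: "degree f \<ge> 1"
  shows "ring_irreducible\<^bsub>Int_ring S\<^esub> f \<longleftrightarrow>
    \<not> (\<exists>g1 g2 d1 d2. g = g1 * g2 \<and> d = d1 * d2 \<and> degree g1 \<ge> 1 \<and> degree g2 \<ge> 1 \<and>
      (\<forall>s\<in>S. d1 dvd poly g1 s \<and> d2 dvd poly g2 s))" (is "_ \<longleftrightarrow> \<not> ?R")
proof -
  have degree_red: "degree h = degree G" if "reduced_fraction h G D" for h G D
    using that by (auto simp: reduced_fraction_def degree_map_of_int)
  have "(\<exists>f1\<in>Int_poly S. \<exists>f2\<in>Int_poly S. f = f1 * f2 \<and> degree f1 \<ge> 1 \<and> degree f2 \<ge> 1) \<longleftrightarrow> ?R"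
    (is "?L \<longleftrightarrow> _")
  proof
    assume "\<exists>f1\<in>Int_poly S. \<exists>f2\<in>Int_poly S. f = f1 * f2 \<and> degree f1 \<ge> 1 \<and> degree f2 \<ge> 1"
    then obtain f1 f2 where f12: "f1 \<in> Int_poly S" "f2 \<in> Int_poly S" "f = f1 * f2"
      "degree f1 \<ge> 1" "degree f2 \<ge> 1" by blast
    obtain g1 d1 g2 d2 where red12: "reduced_fraction f1 g1 d1" "reduced_fraction f2 g2 d2"
      using reduced_fraction_exists by metis
    have deg12: "degree g1 \<ge> 1" "degree g2 \<ge> 1" "degree g \<ge> 1"
      using f12 red12 deg red degree_red by metis+
    have "image_primitive S f1" "image_primitive S f2"
      using image_primitive_factor[of S f1 f2] image_primitive_factor[of S f2 f1] prim f12
      by (auto simp: mult.commute)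
    then have "content g1 = 1" "content g2 = 1" "content g = 1"
      using deg12 reduced_fraction_primitive[OF _ red12(1)] reduced_fraction_primitive[OF _ red12(2)]
        reduced_fraction_primitive[OF prim red] by force+
    with reduced_fraction_mult[OF red[unfolded f12(3)] red12]
    have "g = g1 * g2" "d = d1 * d2" by auto
    moreover have "\<forall>s\<in>S. d1 dvd poly g1 s \<and> d2 dvd poly g2 s"
      using reduced_fraction_values[OF red12(1) f12(1)] reduced_fraction_values[OF red12(2) f12(2)]
      by fastforce
    ultimately show ?R using deg12 by blast
  next
    assume ?R
    then obtain g1 g2 d1 d2 where R: "g = g1 * g2" "d = d1 * d2" "degree g1 \<ge> 1" "degree g2 \<ge> 1"
      "\<forall>s\<in>S. d1 dvd poly g1 s \<and> d2 dvd poly g2 s" by blast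
    have "d > 0" using red by (simp add: reduced_fraction_def)
    then have d0: "d1 \<noteq> 0" "d2 \<noteq> 0" using R(2) by auto
    define q where "q G D = smult (1 / of_int D) (map_poly of_int G :: rat poly)" for G D
    have q: "q G D \<in> Int_poly S" if D: "D \<noteq> 0" "\<forall>s\<in>S. D dvd poly G s" for G D
      unfolding Int_poly_def
    proof (intro CollectI ballI)
      fix s assume "s \<in> S"
      then obtain m where "poly G s = D * m" using D(2) by (auto elim!: dvdE)
      then show "poly (q G D) (of_int s) \<in> \<int>" using D(1) by (simp add: q_def poly_map_of_int)
    qed
    have "f = q g1 d1 * q g2 d2"
      using red by (simp add: reduced_fraction_def q_def R map_of_int_mult mult.commute)
    moreover have "degree (q g1 d1) = degree g1" "degree (q g2 d2) = degree g2"
      using d0 by (simp_all add: q_def degree_map_of_int)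
    ultimately show "\<exists>f1\<in>Int_poly S. \<exists>f2\<in>Int_poly S. f = f1 * f2 \<and> degree f1 \<ge> 1 \<and> degree f2 \<ge> 1"
      using q[OF d0(1), of g1] q[OF d0(2), of g2] R by metis
  qed
  moreover have "ring_irreducible\<^bsub>Int_ring S\<^esub> f \<longleftrightarrow> \<not> ?L"
    unfolding ring_irreducible_Int_ring_iff[OF prim deg]
    by (simp add: Suc_le_eq imp_conjL conj_imp_eq_imp_imp)
  ultimately show ?thesis by simp
qed

subsection \<open>The criterion\<close>

text \<open>Replaces the d_k-ordering at a prime p dividing d by a genuine p-ordering, modulo a
  power of p that is a multiple of the p-part of d.\<close>

lemma dk_ordering_local:
  assumes prim: "image_primitive S f" and red: "reduced_fraction f g d" and deg: "degree f = k" "k \<ge> 1"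
    and dk: "dk_ordering S d k a" and p: "prime p" "p dvd d"
  obtains u e where "p_ordering S p u" "multiplicity p d \<le> e"
    "\<And>i. i < k \<Longrightarrow> [a i = u i] (mod p ^ e)"
    "\<And>n. n \<le> k \<Longrightarrow> w p (gen_fact S n) = pfact p u n"
    "\<And>n. n \<le> k \<Longrightarrow> \<exists>x. pfact p u n = p ^ x"
proof -
  from dk p obtain u e where u: "p_ordering S p u" and e: "p ^ e = w p (gen_fact S k)"
    and a: "\<forall>i\<le>k. [a i = u i] (mod p ^ (e + 1))"
    by (auto simp: dk_ordering_def)
  note S = image_primitive_nonempty[OF prim]
  have "p ^ e \<noteq> 0" using p(1) by auto
  \<comment> \<open>As p^e is nonzero while \<open>w p 0 = 0\<close>, the ordering condition itself
    forces k!_S to be nonzero.\<close>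
  then have nz: "gen_fact S k \<noteq> 0" using e by (auto simp: w_def)
  note w = w_gen_fact[OF S nz _ p(1) u]
  have f: "f \<in> Int_poly S" using prim by (simp add: image_primitive_def)
  have "degree g = k" using red deg by (auto simp: reduced_fraction_def degree_map_of_int)
  moreover have "content g = 1"
    using reduced_fraction_primitive[OF prim red] \<open>degree g = k\<close> deg by (cases "g = 0") auto
  moreover have "p ^ multiplicity p d dvd poly g s" if "s \<in> S" for s
    using reduced_fraction_values[OF red f that] multiplicity_dvd[of p d] by auto
  \<comment> \<open>On S, d divides the values of the primitive g of degree k, so its p-part divides
    that of k!_S.\<close>
  ultimately have "p ^ multiplicity p d dvd p ^ e"
    using primitive_values_dvd_pfact[OF p(1) u, of g k] e w(1)[of k] by simp
  then have le: "multiplicity p d \<le> e"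
    using prime_gt_1_int[OF p(1)] by (simp add: dvd_power_iff)
  have cong: "[a i = u i] (mod p ^ e)" if "i < k" for i
    using a that le_imp_power_dvd[of e "e + 1" p] by (meson cong_dvd_modulus le_add1 less_imp_le_nat)
  have "\<exists>x. pfact p u n = p ^ x" if "n \<le> k" for n
    using w(2)[OF that] prime_power_or_0_w[of p] by (auto simp: pfact_def prime_power_or_0_def)
  with u le cong w(1) show thesis by (rule that)
qed

theorem theorem3p6:
  fixes S :: "int set" and f :: "rat poly" and g :: "int poly" and d :: int
    and k :: nat and a :: "nat \<Rightarrow> int"
  assumes "f \<in> Int_poly S"
    and "image_primitive S f"
    and "reduced_fraction f g d"
    and "degree f = k"
    and "k \<ge> 1"
    and "dk_ordering S d k a"
  shows "ring_irreducible\<^bsub>Int_ring S\<^esub> f \<longleftrightarrow>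
    (\<forall>k1 k2 (b :: nat \<Rightarrow> int) (c :: nat \<Rightarrow> int).
       b k1 \<noteq> 0 \<and> c k2 \<noteq> 0 \<and>
       g = (\<Sum>i\<le>k1. smult (b i) (F a i)) * (\<Sum>j\<le>k2. smult (c j) (F a j)) \<and>
       \<not> is_unit (\<Sum>i\<le>k1. smult (b i) (F a i)) \<and>
       \<not> is_unit (\<Sum>j\<le>k2. smult (c j) (F a j)) \<longrightarrow>
       (\<exists>p r s. prime p \<and> p dvd d \<and> 1 \<le> r \<and> r \<le> k1 \<and> 1 \<le> s \<and> s \<le> k2 \<and>
          w p (gen_fact S r) \<le> w p d \<and> w p (gen_fact S s) \<le> w p d \<and>
          \<not> rat_divides (of_int (mu S r d p) * of_int (mu S s d p) / of_int (w p d))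
                        (of_int (w p (b r * c s)))))"
proof -
  define G where "G n b = (\<Sum>i\<le>n. smult (b i) (F a i))" for n and b :: "nat \<Rightarrow> int"
  define W where "W p r s m n \<longleftrightarrow>
    w p (gen_fact S r) \<le> w p d \<and> w p (gen_fact S s) \<le> w p d \<and>
    \<not> rat_divides (of_int (mu S r d p) * of_int (mu S s d p) / of_int (w p d)) (of_int (w p (m * n)))"
    for p r s m n
  note f = assms(1) and prim = assms(2) and red = assms(3)
  have deg: "degree g = k"
    using red assms(4) by (auto simp: reduced_fraction_def degree_map_of_int)
  have content: "content g = 1"
    using reduced_fraction_primitive[OF prim red] deg assms(5) by (cases "g = 0") auto
  have d: "d > 0" using red by (simp add: reduced_fraction_def)
  have unit: "degree h = 0" if "is_unit h" for h :: "int poly"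
    using that by (auto elim: is_unit_polyE)
  \<comment> \<open>The criterion excludes units, whereas the reduction to numerators excludes
    constants; for factors of the primitive g the two agree.\<close>
  have nonconst: "degree h \<noteq> 0" if h: "content h = 1" "\<not> is_unit h" for h :: "int poly"
  proof
    assume "degree h = 0"
    then obtain c where "h = [:c:]" by (rule degree_eq_zeroE)
    with h show False by (simp add: is_unit_const_poly_iff)
  qed
  have W_iff: "W p r s m n \<longleftrightarrow> \<not> p ^ multiplicity p d dvd (m * pfact p u r) * (n * pfact p u s)"
    if p: "prime p" and x: "w p (gen_fact S r) = pfact p u r" "\<exists>x. pfact p u r = p ^ x"
      "w p (gen_fact S s) = pfact p u s" "\<exists>x. pfact p u s = p ^ x" for p u r s m n
  proof -
    have "w p d = p ^ multiplicity p d" using d by (simp add: w_def)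
    with rat_divides_mu_iff[OF p] x show ?thesis unfolding W_def by (elim exE) simp
  qed
  \<comment> \<open>The left side is reducibility of f, the right side the negation of the stated
    criterion.\<close>
  have "(\<exists>g1 g2 d1 d2. g = g1 * g2 \<and> d = d1 * d2 \<and> degree g1 \<ge> 1 \<and> degree g2 \<ge> 1 \<and>
      (\<forall>s\<in>S. d1 dvd poly g1 s \<and> d2 dvd poly g2 s)) \<longleftrightarrow>
    (\<exists>k1 k2 b c. b k1 \<noteq> 0 \<and> c k2 \<noteq> 0 \<and> g = G k1 b * G k2 c \<and> \<not> is_unit (G k1 b) \<and> \<not> is_unit (G k2 c) \<and>
      (\<forall>p r s. prime p \<and> p dvd d \<and> 1 \<le> r \<and> r \<le> k1 \<and> 1 \<le> s \<and> s \<le> k2 \<longrightarrow> \<not> W p r s (b r) (c s)))"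
    (is "?L \<longleftrightarrow> ?R")
  proof
    assume ?L
    then obtain g1 g2 d1 d2 where g: "g = g1 * g2" "d = d1 * d2" "degree g1 \<ge> 1" "degree g2 \<ge> 1"
      and dvd: "\<And>s. s \<in> S \<Longrightarrow> d1 dvd poly g1 s" "\<And>s. s \<in> S \<Longrightarrow> d2 dvd poly g2 s" by blast
    define k1 k2 where "k1 = degree g1" and "k2 = degree g2"
    obtain b c where b: "g1 = G k1 b" and c: "g2 = G k2 c"
      unfolding G_def using F_expansion[of g1 k1 a] F_expansion[of g2 k2 a] k1_def k2_def by blast
    have "g1 \<noteq> 0" "g2 \<noteq> 0" using g by auto
    then have top: "b k1 \<noteq> 0" "c k2 \<noteq> 0"
      using coeff_sum_F[of b a k1] coeff_sum_F[of c a k2] unfolding G_def[symmetric] b[symmetric] c[symmetric]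
      by (auto simp: k1_def k2_def)
    have "k = k1 + k2"
      using deg g(1) \<open>g1 \<noteq> 0\<close> \<open>g2 \<noteq> 0\<close> by (simp add: degree_mult_eq k1_def k2_def)
    then have k: "k1 \<le> k" "k2 \<le> k" by auto
    have "\<not> W p r s (b r) (c s)"
      if p: "prime p" "p dvd d" and rs: "r \<le> k1" "s \<le> k2" for p r s
    proof -
      obtain u e where u: "p_ordering S p u" "multiplicity p d \<le> e"
        "\<And>i. i < k \<Longrightarrow> [a i = u i] (mod p ^ e)"
        "\<And>n. n \<le> k \<Longrightarrow> w p (gen_fact S n) = pfact p u n"
        "\<And>n. n \<le> k \<Longrightarrow> \<exists>x. pfact p u n = p ^ x"
        by (rule dk_ordering_local[OF prim red assms(4-6) p]) blast
      have "d1 \<noteq> 0" "d2 \<noteq> 0" using d g(2) by auto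
      \<comment> \<open>The p-part of each denominator divides the values of its own factor, hence
        each coefficient times its local factorial; the exponents add up to that of d.\<close>
      then have m: "multiplicity p d = multiplicity p d1 + multiplicity p d2"
        unfolding g(2) using p(1) by (intro prime_elem_multiplicity_mult_distrib) auto
      have "p ^ multiplicity p d1 dvd b r * pfact p u r"
        using dvd_values_iff_cong[OF p(1) u(1), of "multiplicity p d1" e k1 a b] m u(2,3) k rs(1)
          dvd_trans[OF multiplicity_dvd dvd(1)] by (auto simp: G_def[symmetric] b[symmetric])
      moreover have "p ^ multiplicity p d2 dvd c s * pfact p u s"
        using dvd_values_iff_cong[OF p(1) u(1), of "multiplicity p d2" e k2 a c] m u(2,3) k rs(2)
          dvd_trans[OF multiplicity_dvd dvd(2)] by (auto simp: G_def[symmetric] c[symmetric])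
      ultimately have "p ^ multiplicity p d dvd (b r * pfact p u r) * (c s * pfact p u s)"
        unfolding m power_add by (rule mult_dvd_mono)
      then show ?thesis using W_iff[OF p(1), of r u s] u(4,5) rs k by simp
    qed
    then show ?R using top g unit[of g1] unit[of g2] b c
      by (intro exI[of _ k1] exI[of _ k2] exI[of _ b] exI[of _ c]) auto
  next
    assume ?R
    then obtain k1 k2 b c where top: "b k1 \<noteq> 0" "c k2 \<noteq> 0" and g: "g = G k1 b * G k2 c"
      and nonunit: "\<not> is_unit (G k1 b)" "\<not> is_unit (G k2 c)"
      and W: "\<And>p r s. prime p \<Longrightarrow> p dvd d \<Longrightarrow> 1 \<le> r \<Longrightarrow> r \<le> k1 \<Longrightarrow> 1 \<le> s \<Longrightarrow> s \<le> k2 \<Longrightarrow>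
        \<not> W p r s (b r) (c s)" by blast
    define g1 g2 where "g1 = G k1 b" and "g2 = G k2 c"
    have deg12: "degree g1 = k1" "degree g2 = k2"
      using degree_sum_F[of b k1 a] degree_sum_F[of c k2 a] top by (simp_all add: g1_def g2_def G_def)
    have "content g1 = 1" "content g2 = 1"
      using content g content_prod_eq_1_iff[of g1 g2] by (auto simp: g1_def g2_def)
    then have "degree g1 \<noteq> 0" "degree g2 \<noteq> 0"
      using nonunit nonconst unfolding g1_def[symmetric] g2_def[symmetric] by blast+
    then have "degree g1 \<ge> 1" "degree g2 \<ge> 1" by simp_all
    have nz: "g1 \<noteq> 0" "g2 \<noteq> 0" using \<open>degree g1 \<noteq> 0\<close> \<open>degree g2 \<noteq> 0\<close> by auto
    have "k = k1 + k2"
      using deg g deg12 nz by (simp add: degree_mult_eq g1_def[symmetric] g2_def[symmetric])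
    then have k: "k1 \<le> k" "k2 \<le> k" by auto
    \<comment> \<open>These are the fixed divisors of the two factors on S. The split exponent y
      varies with p, but divisibility of \<open>m * n\<close> by d can be tested one prime at a
      time.\<close>
    define m n where "m = Gcd (poly g1 ` S)" and "n = Gcd (poly g2 ` S)"
    have "p ^ multiplicity p d dvd m * n" if p: "prime p" "p dvd d" for p
    proof -
      obtain u e where u: "p_ordering S p u" "multiplicity p d \<le> e"
        "\<And>i. i < k \<Longrightarrow> [a i = u i] (mod p ^ e)"
        "\<And>n. n \<le> k \<Longrightarrow> w p (gen_fact S n) = pfact p u n"
        "\<And>n. n \<le> k \<Longrightarrow> \<exists>x. pfact p u n = p ^ x"
        by (rule dk_ordering_local[OF prim red assms(4-6) p]) blast
      have "\<exists>y\<le>multiplicity p d. \<forall>s\<in>S. p ^ y dvd poly g1 s \<and> p ^ (multiplicity p d - y) dvd poly g2 s"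
      proof (rule values_split[OF p(1) u(1,2)])
        show "[a i = u i] (mod p ^ e)" if "i < max k1 k2" for i
          using u(3)[of i] that k by auto
        show "p ^ multiplicity p d dvd (b r * pfact p u r) * (c s * pfact p u s)"
          if "1 \<le> r" "r \<le> k1" "1 \<le> s" "s \<le> k2" for r s
          using W[OF p that] W_iff[OF p(1), of r u s "b r" "c s"] u(4,5) k that by simp
        show "p ^ multiplicity p d dvd poly g1 s * poly g2 s" if "s \<in> S" for s
          using reduced_fraction_values[OF red f that] multiplicity_dvd[of p d] g
          by (auto simp: g1_def g2_def)
      qed (simp_all add: g1_def g2_def G_def)
      then obtain y where y: "y \<le> multiplicity p d" "p ^ y dvd m" "p ^ (multiplicity p d - y) dvd n"
        by (auto simp: m_def n_def intro!: Gcd_greatest)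
      from mult_dvd_mono[OF y(2,3)] y(1) show ?thesis by (simp add: power_add[symmetric])
    qed
    then have mult: "multiplicity p d \<le> multiplicity p (m * n)" if "prime p" "m * n \<noteq> 0" for p
      using that by (cases "p dvd d") (auto simp: not_dvd_imp_multiplicity_0 intro!: multiplicity_geI)
    have "d dvd m * n"
    proof (cases "m * n = 0")
      case False
      then show ?thesis using d mult by (intro multiplicity_le_imp_dvd) auto
    qed (simp only: dvd_0_right)
    \<comment> \<open>Divisibility of the product yields a single split of d that serves all primes
      at once.\<close>
    then obtain d1 d2 where d12: "d = d1 * d2" "d1 dvd m" "d2 dvd n"
      using division_decomp[of d m n] by blast
    have "d1 dvd poly g1 s \<and> d2 dvd poly g2 s" if "s \<in> S" for s
      using that d12(2,3) by (auto simp: m_def n_def intro: dvd_trans Gcd_dvd)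
    then show ?L
      using g d12(1) \<open>degree g1 \<ge> 1\<close> \<open>degree g2 \<ge> 1\<close> unfolding g1_def[symmetric] g2_def[symmetric]
      by blast
  qed
  moreover have "ring_irreducible\<^bsub>Int_ring S\<^esub> f \<longleftrightarrow> \<not> ?L"
    using assms(4,5) by (intro ring_irreducible_iff_numerator[OF prim red]) simp
  ultimately have "ring_irreducible\<^bsub>Int_ring S\<^esub> f \<longleftrightarrow> \<not> ?R" by (simp only:)
  then show ?thesis unfolding W_def G_def by blast
qed

end
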